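(* Let $k>1$ be an integer, let $a_1,\ldots,a_k\in\mathbb{Z}$, $n_1,\ldots,n_k\in\mathbb{Z}^+$, and let $\lambda_1,\ldots,\lambda_k\in\mathbb{Z}$ be weights. Define $w:\mathbb{Z}\to\mathbb{Z}$ by $w(x)=\sum_{1\leqslant s\leqslant k,\ n_s\mid x-a_s}\lambda_s$. Let $m\in\mathbb{Z}$ and suppose $n_0\in\mathbb{Z}^+$ is the smallest positive period of $w$ modulo $m$, i.e., the least positive integer with $w(x+n_0)\equiv w(x)\ (\mathrm{mod}\ m)$ for all $x\in\mathbb{Z}$. Let $d\in\mathbb{Z}^+$ be such that $d\nmid n_0$ and $I(d)=\{1\leqslant s\leqslant k: d\mid n_s\}\neq\emptyset$. Then either $m$ divides $[n_1,\ldots,n_k]\sum_{s\in I(d)}\lambda_s/n_s$ (where $[n_1,\ldots,n_k]$ is the least common multiple), or $$|I(d)|\geqslant |\{a_s\ \mathrm{mod}\ d:\ s\in I(d)\}|\geqslant \min_{\substack{0\leqslant s\leqslant k\\ s\notin I(d)}}\frac{d}{(d,n_s)}\geqslant p(d),$$ where $\{a_s\ \mathrm{mod}\ d: s\in I(d)\}$ is the set of residues of the $a_s$ ($s\in I(d)$) modulo $d$, $(d,n_s)$ is the greatest common divisor, and $p(d)$ is the smallest prime divisor of $d$.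
   Context: Congruence modulo $0$ means equality, and "$0$ divides $y$" means $y=0$. The minimum in the displayed inequality ranges over indices $s\in\{0,1,\ldots,k\}$ not in $I(d)$, including $s=0$ (with modulus $n_0$). *)

theory Defs
  imports Complex_Main "HOL-Number_Theory.Cong"
begin

definition weight_fun ::
    "nat \<Rightarrow> (nat \<Rightarrow> int) \<Rightarrow> (nat \<Rightarrow> nat) \<Rightarrow> (nat \<Rightarrow> int) \<Rightarrow> int \<Rightarrow> int" where
  "weight_fun k a n lam x = (\<Sum>s\<in>{s\<in>{1..k}. int (n s) dvd x - a s}. lam s)"

(* The modulus m may be 0 (congruence is then equality) or negative. *)
definition period_mod :: "(int \<Rightarrow> int) \<Rightarrow> int \<Rightarrow> nat \<Rightarrow> bool" where
  "period_mod w m t \<longleftrightarrow> 0 < t \<and> (\<forall>x. [w (x + int t) = w x] (mod m))"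

definition smallest_period_mod :: "(int \<Rightarrow> int) \<Rightarrow> int \<Rightarrow> nat \<Rightarrow> bool" where
  "smallest_period_mod w m t \<longleftrightarrow> period_mod w m t \<and> (\<forall>t'. period_mod w m t' \<longrightarrow> t \<le> t')"

definition index_set :: "nat \<Rightarrow> (nat \<Rightarrow> nat) \<Rightarrow> nat \<Rightarrow> nat set" where
  "index_set k n d = {s\<in>{1..k}. d dvd n s}"

(* Only meaningful for d > 1. *)
definition least_prime_divisor :: "nat \<Rightarrow> nat" where
  "least_prime_divisor d = (LEAST p. prime p \<and> p dvd d)"

(* Divisibility of a rational number by an integer: in the type rat itself
   dvd is trivial, so the number is required to be an integer divisible by m. *)
definition int_dvd_rat :: "int \<Rightarrow> rat \<Rightarrow> bool" where
  "int_dvd_rat m q \<longleftrightarrow> (\<exists>z::int. q = of_int z \<and> m dvd z)"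

end

theory Submission
  imports Defs "Jordan_Normal_Form.Char_Poly"
begin

text \<open>
  Let \<open>N = [n\<^sub>1, \<dots>, n\<^sub>k]\<close>, a multiple of \<open>n\<^sub>0\<close>, and let \<open>z\<close> be a \<open>d\<close>-th root of unity with
  \<open>z ^ n\<^sub>s \<noteq> 1\<close> for every \<open>s \<notin> I(d)\<close>, including \<open>s = 0\<close>. Computing \<open>\<Sum>x<N. w(x) z\<^sup>x\<close> from the definition
  of \<open>w\<close> leaves only the terms with \<open>s \<in> I(d)\<close>; computing it from the period \<open>n\<^sub>0\<close> modulo \<open>m\<close> shows that
  it lies in \<open>m \<int>[z]\<close>. With \<open>\<zeta>\<close> a primitive \<open>d\<close>-th root of unity this applies to \<open>z = \<zeta>\<^sup>j\<close> for
  \<open>0 < j < min d / (d, n\<^sub>s)\<close>. If there were fewer residues \<open>a\<^sub>s mod d\<close> than this minimum, Vandermonde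
  elimination over \<open>\<int>[\<zeta>]\<close> would give the same for \<open>j = 0\<close>, so that \<open>N \<Sum>s\<in>I(d). \<lambda>\<^sub>s / n\<^sub>s\<close> is an
  integer in \<open>m \<int>[\<zeta>]\<close> and hence, the elements of \<open>\<int>[\<zeta>]\<close> being algebraic integers, a multiple of \<open>m\<close>.
\<close>

section \<open>Ring operations on integer combinations of powers\<close>

text \<open>The ring \<open>\<int>[z]\<close>, generated additively by the powers of \<open>z\<close>.\<close>

inductive_set int_adjoin :: "complex \<Rightarrow> complex set" for z where
  zero: "0 \<in> int_adjoin z"
| add_power: "x \<in> int_adjoin z \<Longrightarrow> x + z ^ i \<in> int_adjoin z"
| diff_power: "x \<in> int_adjoin z \<Longrightarrow> x - z ^ i \<in> int_adjoin z"

lemma int_adjoin_power: "z ^ i \<in> int_adjoin z"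
  using int_adjoin.add_power[OF int_adjoin.zero, of z i] by simp

lemma int_adjoin_add:
  assumes "x \<in> int_adjoin z" "y \<in> int_adjoin z"
  shows "x + y \<in> int_adjoin z"
  using assms(2)
proof induction
  case (add_power y i)
  then show ?case
    using int_adjoin.add_power[of "x + y" z i] by (simp add: algebra_simps)
next
  case (diff_power y i)
  then show ?case
    using int_adjoin.diff_power[of "x + y" z i] by (simp add: algebra_simps)
qed (use assms(1) in simp)

lemma int_adjoin_uminus:
  assumes "x \<in> int_adjoin z"
  shows "- x \<in> int_adjoin z"
  using assms
proof induction
  case (add_power y i)
  then show ?case
    using int_adjoin.diff_power[of "- y" z i] by (simp add: algebra_simps)
next
  case (diff_power y i)
  then show ?case
    using int_adjoin.add_power[of "- y" z i] by (simp add: algebra_simps)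
qed (simp add: int_adjoin.zero)

lemma int_adjoin_diff:
  "x \<in> int_adjoin z \<Longrightarrow> y \<in> int_adjoin z \<Longrightarrow> x - y \<in> int_adjoin z"
  using int_adjoin_add[of x z "- y"] int_adjoin_uminus[of y z] by simp

lemma int_adjoin_mult:
  assumes "x \<in> int_adjoin z" "y \<in> int_adjoin z"
  shows "x * y \<in> int_adjoin z"
  using assms(1)
proof induction
  case zero
  show ?case by (simp add: int_adjoin.zero)
next
  have power: "z ^ i * y \<in> int_adjoin z" for i
    using assms(2)
  proof induction
    case zero
    show ?case by (simp add: int_adjoin.zero)
  next
    case (add_power y j)
    then show ?case
      using int_adjoin.add_power[of "z ^ i * y" z "i + j"] by (simp add: algebra_simps power_add)
  next
    case (diff_power y j)
    then show ?case
      using int_adjoin.diff_power[of "z ^ i * y" z "i + j"] by (simp add: algebra_simps power_add)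
  qed
  {
    case (add_power x i)
    then show ?case using int_adjoin_add[OF _ power] by (simp add: distrib_right)
  next
    case (diff_power x i)
    then show ?case using int_adjoin_diff[OF _ power] by (simp add: left_diff_distrib)
  }
qed

lemma int_adjoin_of_int: "of_int c \<in> int_adjoin z"
proof (induction c rule: int_induct[where k = 0])
  case base
  show ?case by (simp add: int_adjoin.zero)
next
  case (step1 i)
  then show ?case using int_adjoin.add_power[of _ z 0] by simp
next
  case (step2 i)
  then show ?case using int_adjoin.diff_power[of _ z 0] by simp
qed

lemma int_adjoin_of_power: "x \<in> int_adjoin (z ^ j) \<Longrightarrow> x \<in> int_adjoin z"
  by (induction rule: int_adjoin.induct)
     (auto simp flip: power_mult intro: int_adjoin.intros)

section \<open>Integrality over a root of unity\<close>

text \<open>As \<open>z ^ d = 1\<close>, exponents may be reduced modulo \<open>d\<close>, so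
  finitely many powers generate \<int>[z] additively. No independence of these powers is
  claimed.\<close>

lemma int_adjoin_imp_combination:
  assumes "x \<in> int_adjoin z" "z ^ d = 1" "d > 0"
  shows "\<exists>c :: nat \<Rightarrow> int. x = (\<Sum>i<d. of_int (c i) * z ^ i)"
  using assms(1)
proof induction
  case zero
  show ?case by (intro exI[of _ "\<lambda>_. 0"]) simp
next
  have reduce: "z ^ i = z ^ (i mod d)" for i
  proof -
    have "z ^ i = z ^ (d * (i div d) + i mod d)" by simp
    also have "\<dots> = z ^ (i mod d)"
      unfolding power_add power_mult assms(2) by simp
    finally show ?thesis .
  qed
  have update: "\<exists>c' :: nat \<Rightarrow> int. (\<Sum>i<d. of_int (c i) * z ^ i) + of_int e * z ^ j
      = (\<Sum>i<d. of_int (c' i) * z ^ i)" for c :: "nat \<Rightarrow> int" and e :: int and j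
  proof -
    let ?j = "j mod d"
    have j: "?j \<in> {..<d}" using assms(3) by simp
    have "(\<Sum>i<d. of_int ((c(?j := c ?j + e)) i) * z ^ i)
        = of_int (c ?j + e) * z ^ ?j + (\<Sum>i\<in>{..<d} - {?j}. of_int (c i) * z ^ i)"
      by (subst sum.remove[OF _ j]) (auto intro!: sum.cong)
    also have "\<dots> = (\<Sum>i<d. of_int (c i) * z ^ i) + of_int e * z ^ j"
      by (subst sum.remove[OF _ j]) (auto simp: algebra_simps reduce[of j])
    finally show ?thesis by metis
  qed
  {
    case (add_power x i)
    then show ?case using update[of _ 1 i] by auto
  next
    case (diff_power x i)
    then show ?case using update[of _ "-1" i] by auto
  }
qed

text \<open>Multiplication by \<open>x\<close> acts on the generators \<open>z ^ j\<close>,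
  \<open>j < d\<close>, through an integer matrix. The vector of these powers is an eigenvector for
  \<open>x\<close>, nonzero because its entry at 0 is 1. Hence \<open>x\<close> is a root of a monic
  integer polynomial, the characteristic polynomial.\<close>

lemma algebraic_int_int_adjoin:
  assumes "x \<in> int_adjoin z" "z ^ d = 1" "d > 0"
  shows "algebraic_int x"
proof -
  have "\<exists>c :: nat \<Rightarrow> int. x * z ^ j = (\<Sum>i<d. of_int (c i) * z ^ i)" for j
    by (intro int_adjoin_imp_combination int_adjoin_mult assms int_adjoin_power)
  then obtain C :: "nat \<Rightarrow> nat \<Rightarrow> int"
    where C: "\<And>j. x * z ^ j = (\<Sum>i<d. of_int (C j i) * z ^ i)"
    by metis
  define A where "A = mat d d (\<lambda>(j, i). C j i)"
  define v where "v = vec d (\<lambda>i. z ^ i)"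
  let ?A = "map_mat complex_of_int A"
  have A: "A \<in> carrier_mat d d" by (simp add: A_def)
  have "?A *\<^sub>v v = x \<cdot>\<^sub>v v"
    by (rule eq_vecI)
       (auto simp: A_def v_def C scalar_prod_def lessThan_atLeast0 intro!: sum.cong)
  moreover have "v \<noteq> 0\<^sub>v d"
    using assms(3) by (metis index_vec index_zero_vec(1) power_0 v_def zero_neq_one)
  moreover have "v \<in> carrier_vec d" by (simp add: v_def)
  ultimately have "eigenvalue ?A x"
    using A unfolding eigenvalue_def eigenvector_def by auto
  then have "poly (char_poly ?A) x = 0"
    using eigenvalue_root_char_poly[of ?A d x] A by auto
  moreover have "char_poly ?A = map_poly of_int (char_poly A)"
    by (rule of_int_hom.char_poly_hom[OF A])
  moreover have "monic (char_poly A)"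
    using degree_monic_char_poly[OF A] by simp
  ultimately show ?thesis
    unfolding algebraic_int_altdef_ipoly by auto
qed

section \<open>The ideal of multiples of m\<close>

text \<open>For \<open>m = 0\<close> this is the zero ideal, in agreement with congruence modulo 0
  being equality.\<close>

definition int_adjoin_multiple :: "int \<Rightarrow> complex \<Rightarrow> complex set" where
  "int_adjoin_multiple m z = (\<lambda>y. of_int m * y) ` int_adjoin z"

text \<open>For nonzero \<open>m\<close> the quotient \<open>c / m\<close> is both rational and an
  algebraic integer, hence an integer.\<close>

lemma int_adjoin_multiple_dvd:
  assumes "of_int c \<in> int_adjoin_multiple m z" "z ^ d = 1" "d > 0"
  shows "m dvd c"
proof (cases "m = 0")
  case True
  then show ?thesis using assms(1) by (auto simp: int_adjoin_multiple_def)
next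
  case False
  obtain y where y: "y \<in> int_adjoin z" "of_int c = of_int m * y"
    using assms(1) by (auto simp: int_adjoin_multiple_def)
  have "y = of_int c / of_int m"
    using y(2) False by (simp add: field_simps)
  then have "y \<in> \<rat>" by simp
  with algebraic_int_int_adjoin[OF y(1) assms(2,3)] have "y \<in> \<int>"
    by (rule rational_algebraic_int_is_int)
  then obtain q where "y = of_int q" by (rule Ints_cases)
  with y(2) have "complex_of_int c = of_int (m * q)" by simp
  then show ?thesis by (metis dvd_triv_left of_int_eq_iff)
qed

lemma int_adjoin_multiple_zero: "0 \<in> int_adjoin_multiple m z"
  unfolding int_adjoin_multiple_def by (rule image_eqI[OF _ int_adjoin.zero]) simp

lemma int_adjoin_multiple_add:
  "x \<in> int_adjoin_multiple m z \<Longrightarrow> y \<in> int_adjoin_multiple m z \<Longrightarrow>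
    x + y \<in> int_adjoin_multiple m z"
  unfolding int_adjoin_multiple_def
  by (auto simp flip: distrib_left intro!: imageI int_adjoin_add)

lemma int_adjoin_multiple_mult:
  assumes "x \<in> int_adjoin_multiple m z" "y \<in> int_adjoin z"
  shows "y * x \<in> int_adjoin_multiple m z"
proof -
  obtain u where "u \<in> int_adjoin z" "x = of_int m * u"
    using assms(1) by (auto simp: int_adjoin_multiple_def)
  then show ?thesis
    unfolding int_adjoin_multiple_def
    by (intro image_eqI[of _ _ "y * u"] int_adjoin_mult assms(2)) auto
qed

lemma int_adjoin_multiple_diff:
  assumes "x \<in> int_adjoin_multiple m z" "y \<in> int_adjoin_multiple m z"
  shows "x - y \<in> int_adjoin_multiple m z"
  using int_adjoin_multiple_add[OF assms(1) int_adjoin_multiple_mult[OF assms(2)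
        int_adjoin_of_int[of "-1"]]] by simp

lemma int_adjoin_multiple_sum:
  "(\<And>i. i \<in> A \<Longrightarrow> f i \<in> int_adjoin_multiple m z) \<Longrightarrow> sum f A \<in> int_adjoin_multiple m z"
  by (induction A rule: infinite_finite_induct)
     (auto intro: int_adjoin_multiple_zero int_adjoin_multiple_add)

lemma int_adjoin_multiple_of_int: "m dvd c \<Longrightarrow> of_int c \<in> int_adjoin_multiple m z"
  unfolding int_adjoin_multiple_def by (auto elim!: dvdE intro!: imageI int_adjoin_of_int)

text \<open>Collects the information obtained at the various powers of one root of unity in a single
  ideal, where elimination can take place.\<close>

lemma int_adjoin_multiple_of_power:
  "x \<in> int_adjoin_multiple m (z ^ j) \<Longrightarrow> x \<in> int_adjoin_multiple m z"
  unfolding int_adjoin_multiple_def using int_adjoin_of_power by blast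

section \<open>Exponential sums with few nodes\<close>

text \<open>
  A Vandermonde elimination: replacing the coefficient \<open>c r\<close> by \<open>c r * (1 - z\<^sup>r / z\<^sup>t)\<close> removes the
  index \<open>t\<close> at the cost of one exponent. The nodes \<open>z\<^sup>r\<close> need not be distinct.
\<close>

lemma exponential_sum_multiple:
  fixes c :: "nat \<Rightarrow> complex"
  assumes "finite R" "z ^ d = 1" "d > 0"
    and "\<And>j. j \<in> {1..card R} \<Longrightarrow> (\<Sum>r\<in>R. c r * (z ^ j) ^ r) \<in> int_adjoin_multiple m z"
  shows "sum c R \<in> int_adjoin_multiple m z"
  using assms(1,4)
proof (induction R arbitrary: c rule: finite_induct)
  case empty
  show ?case by (simp add: int_adjoin_multiple_zero)
next
  case (insert t R)
  \<comment> \<open>This is the inverse of \<open>z ^ t\<close>, written with a nonnegative exponent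
    so that it visibly lies in \<int>[z].\<close>
  define u where "u = z ^ ((d - 1) * t)"
  have u: "u * z ^ t = 1"
  proof -
    have "u * z ^ t = z ^ ((d - 1) * t + t)" by (simp add: u_def power_add)
    also have "(d - 1) * t + t = d * t"
      using assms(3) by (cases d) auto
    finally show ?thesis by (simp add: power_mult assms(2))
  qed
  define b where "b = (\<lambda>r. c r * (1 - u * z ^ r))"
  define T where "T = (\<lambda>j. \<Sum>r\<in>insert t R. c r * (z ^ j) ^ r)"
  have step: "(\<Sum>r\<in>R. b r * (z ^ j) ^ r) = T j - u * T (Suc j)" for j
  proof -
    have "(\<Sum>r\<in>R. b r * (z ^ j) ^ r) = (\<Sum>r\<in>insert t R. b r * (z ^ j) ^ r)"
      using insert.hyps by (simp add: b_def u)
    also have "\<dots> = T j - u * T (Suc j)"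
      unfolding T_def b_def sum_distrib_left sum_subtractf[symmetric]
      by (intro sum.cong) (simp_all add: algebra_simps power_mult_distrib)
    finally show ?thesis .
  qed
  have T: "T j \<in> int_adjoin_multiple m z" if "j \<in> {1..Suc (card R)}" for j
    unfolding T_def using insert.prems[of j] insert.hyps that by simp
  have uT: "u * T j \<in> int_adjoin_multiple m z" if "j \<in> {1..Suc (card R)}" for j
    unfolding u_def by (intro int_adjoin_multiple_mult T that int_adjoin_power)
  \<comment> \<open>The induction hypothesis needs exponents up to \<open>card R\<close>; each uses
    \<open>T j\<close> and \<open>T (Suc j)\<close>, so the range up to \<open>Suc (card R)\<close>
    is exactly enough. Then \<open>step\<close> at exponent 0 recovers \<open>T 0\<close> from
    \<open>T 1\<close>.\<close>
  have "sum b R \<in> int_adjoin_multiple m z"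
    by (rule insert.IH) (auto simp: step intro!: int_adjoin_multiple_diff T uT)
  then have "T 0 - u * T 1 \<in> int_adjoin_multiple m z"
    using step[of 0] by simp
  from int_adjoin_multiple_add[OF this uT[of 1]] show ?case
    by (simp add: T_def)
qed

section \<open>Sums over residue classes\<close>

lemma sum_arith_progression:
  fixes f :: "nat \<Rightarrow> 'a::comm_monoid_add"
  assumes "n > 0" "n dvd N"
  shows "(\<Sum>x | x < N \<and> int n dvd int x - a. f x) = (\<Sum>q<N div n. f (nat (a mod int n) + n * q))"
proof -
  define r where "r = nat (a mod int n)"
  have r: "int r = a mod int n" "r < n"
    using assms(1) by (auto simp: r_def nat_less_iff)
  have dvd_iff: "int n dvd int x - a \<longleftrightarrow> x mod n = r" for x
    by (metis mod_eq_dvd_iff of_nat_eq_iff of_nat_mod r(1))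
  have "(\<Sum>q<N div n. f (r + n * q)) = (\<Sum>x | x < N \<and> x mod n = r. f x)"
  proof (rule sum.reindex_bij_witness[of _ "\<lambda>x. x div n" "\<lambda>q. r + n * q"])
    fix q assume "q \<in> {..<N div n}"
    then have "n * Suc q \<le> n * (N div n)" by (intro mult_le_mono2) auto
    also have "n * (N div n) = N" using assms by simp
    finally have "r + n * q < N" using r by simp
    then show "r + n * q \<in> {x. x < N \<and> x mod n = r}" using r by simp
  next
    fix x assume "x \<in> {x. x < N \<and> x mod n = r}"
    then show "x div n \<in> {..<N div n}"
      using assms by (auto simp: div_less_iff_less_mult)
  qed (use r in auto)
  then show ?thesis by (simp add: dvd_iff r_def)
qed

lemma sum_powers_root_of_unity:
  fixes z :: complex
  assumes "z ^ M = 1"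
  shows "(\<Sum>q<M. z ^ q) = (if z = 1 then of_nat M else 0)"
  using assms by (simp add: geometric_sum)

text \<open>A geometric sum of ratio \<open>z ^ n\<close>, which is an \<open>N div n\<close>-th
  root of unity.\<close>

lemma sum_arith_progression_powers:
  fixes z :: complex
  assumes "n > 0" "n dvd N" "z ^ N = 1"
  shows "(\<Sum>x | x < N \<and> int n dvd int x - a. z ^ x)
    = (if z ^ n = 1 then of_nat (N div n) * z ^ nat (a mod int n) else 0)"
proof -
  have "(z ^ n) ^ (N div n) = 1"
    using assms by (simp flip: power_mult)
  then show ?thesis
    unfolding sum_arith_progression[OF assms(1,2)] power_add power_mult
    by (simp flip: sum_distrib_left add: sum_powers_root_of_unity)
qed

section \<open>Periods modulo m\<close>

lemma period_mod_mult:
  assumes "period_mod w m t"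
  shows "[w (x + int (t * q)) = w x] (mod m)"
proof (induction q)
  case 0
  show ?case by simp
next
  case (Suc q)
  have "[w (x + int (t * q) + int t) = w (x + int (t * q))] (mod m)"
    using assms by (simp add: period_mod_def)
  with Suc show ?case by (auto simp: algebra_simps intro: cong_trans)
qed

text \<open>Otherwise the remainder \<open>N mod t\<close> would be a smaller positive
  period.\<close>

lemma smallest_period_mod_dvd:
  assumes "smallest_period_mod w m t" "period_mod w m N"
  shows "t dvd N"
proof (rule ccontr)
  assume "\<not> t dvd N"
  then have pos: "N mod t > 0" by (simp add: mod_greater_zero_iff_not_dvd)
  have t: "period_mod w m t" "\<And>t'. period_mod w m t' \<Longrightarrow> t \<le> t'"
    using assms(1) by (auto simp: smallest_period_mod_def)
  have "[w (x + int (N mod t)) = w x] (mod m)" for x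
  proof -
    have eq: "x + int (N mod t) + int (t * (N div t)) = x + int N"
      by (metis add.assoc mod_mult_div_eq of_nat_add)
    have "[w (x + int N) = w (x + int (N mod t))] (mod m)"
      using period_mod_mult[OF t(1), of "x + int (N mod t)" "N div t"] unfolding eq .
    moreover have "[w (x + int N) = w x] (mod m)"
      using assms(2) by (simp add: period_mod_def)
    ultimately show ?thesis using cong_sym cong_trans by blast
  qed
  then have "t \<le> N mod t" using pos by (intro t(2)) (simp add: period_mod_def)
  moreover have "N mod t < t" using t(1) by (simp add: period_mod_def)
  ultimately show False by simp
qed

lemma period_mod_weight_fun:
  assumes "N > 0" "\<And>s. s \<in> {1..k} \<Longrightarrow> n s dvd N"
  shows "period_mod (weight_fun k a n lam) m N"
proof -
  have "int (n s) dvd x + int N - a s \<longleftrightarrow> int (n s) dvd x - a s" if "s \<in> {1..k}" for s x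
  proof -
    have "int (n s) dvd int N" using assms(2)[OF that] by simp
    moreover have "x + int N - a s = (x - a s) + int N" by simp
    ultimately show ?thesis by (metis dvd_add_left_iff)
  qed
  then have "weight_fun k a n lam (x + int N) = weight_fun k a n lam x" for x
    unfolding weight_fun_def by (intro sum.cong) auto
  then show ?thesis using assms(1) by (simp add: period_mod_def)
qed

section \<open>Two evaluations of a Fourier coefficient\<close>

text \<open>Modulo \<open>m\<close>, every block of length \<open>t\<close> repeats the values of
  \<open>w\<close> on the first one. An exact repetition would sum to zero, since the powers of
  \<open>z ^ t\<close> cancel; only the differences remain, and \<open>m\<close> divides
  them.\<close>

lemma fourier_coefficient_multiple:
  fixes w :: "int \<Rightarrow> int"
  assumes "period_mod w m t" "t dvd N" "z ^ N = 1" "z ^ t \<noteq> 1"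
  shows "(\<Sum>x<N. of_int (w (int x)) * z ^ x) \<in> int_adjoin_multiple m z"
proof -
  define f where "f = (\<lambda>x. of_int (w (int x)) * z ^ x)"
  \<comment> \<open>The summand of \<open>f\<close> at \<open>t * q + r\<close> with the value of
    \<open>w\<close> taken from the first block.\<close>
  define g where "g = (\<lambda>q r. of_int (w (int r)) * z ^ (t * q + r))"
  have N: "N = (N div t) * t" using assms(2) by simp
  have block: "sum f {q * t..<q * t + t} = (\<Sum>r<t. f (t * q + r))" for q
    by (rule sum.reindex_bij_witness[of _ "\<lambda>r. t * q + r" "\<lambda>x. x - t * q"])
       (auto simp: mult.commute)
  have "sum f {..<N} = (\<Sum>q<N div t. \<Sum>r<t. f (t * q + r))"
    unfolding block[symmetric] by (subst N) (rule sum.nat_group[symmetric])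
  also have "\<dots> = (\<Sum>q<N div t. \<Sum>r<t. f (t * q + r) - g q r) + (\<Sum>q<N div t. \<Sum>r<t. g q r)"
    by (simp add: sum_subtractf)
  also have "(\<Sum>q<N div t. \<Sum>r<t. g q r)
      = (\<Sum>q<N div t. (z ^ t) ^ q) * (\<Sum>r<t. of_int (w (int r)) * z ^ r)"
    unfolding g_def sum_product by (intro sum.cong refl) (simp add: power_add power_mult)
  also have "(\<Sum>q<N div t. (z ^ t) ^ q) = 0"
    using assms by (subst sum_powers_root_of_unity) (auto simp flip: power_mult)
  finally have eq: "sum f {..<N} = (\<Sum>q<N div t. \<Sum>r<t. f (t * q + r) - g q r)" by simp
  have "f (t * q + r) - g q r \<in> int_adjoin_multiple m z" for q r
  proof -
    have "f (t * q + r) - g q r = z ^ (t * q + r) * of_int (w (int (t * q + r)) - w (int r))"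
      by (simp add: f_def g_def algebra_simps)
    moreover have "m dvd w (int (t * q + r)) - w (int r)"
      using period_mod_mult[OF assms(1), of "int r" q] by (simp add: cong_iff_dvd_diff add.commute)
    ultimately show ?thesis
      by (metis int_adjoin_multiple_mult int_adjoin_multiple_of_int int_adjoin_power)
  qed
  then have "sum f {..<N} \<in> int_adjoin_multiple m z"
    unfolding eq by (intro int_adjoin_multiple_sum)
  then show ?thesis by (simp add: f_def)
qed

text \<open>After exchanging the sums, each residue class gives a geometric sum, which vanishes
  unless \<open>z ^ n s = 1\<close>.\<close>

lemma fourier_coefficient_weight_fun:
  fixes z :: complex
  assumes "\<And>s. s \<in> {1..k} \<Longrightarrow> n s > 0 \<and> n s dvd N" "z ^ N = 1"
  shows "(\<Sum>x<N. of_int (weight_fun k a n lam (int x)) * z ^ x)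
    = (\<Sum>s | s \<in> {1..k} \<and> z ^ n s = 1.
        of_int (lam s) * of_nat (N div n s) * z ^ nat (a s mod int (n s)))"
proof -
  have "(\<Sum>x<N. of_int (weight_fun k a n lam (int x)) * z ^ x)
      = (\<Sum>x<N. \<Sum>s\<in>{1..k}. if int (n s) dvd int x - a s then of_int (lam s) * z ^ x else 0)"
    unfolding weight_fun_def of_int_sum sum_distrib_right
    by (intro sum.cong refl sum.inter_filter) simp
  also have "\<dots> = (\<Sum>s\<in>{1..k}. of_int (lam s) * (\<Sum>x | x < N \<and> int (n s) dvd int x - a s. z ^ x))"
    by (subst sum.swap, intro sum.cong refl)
       (simp add: sum_distrib_left flip: sum.inter_filter)
  also have "\<dots> = (\<Sum>s\<in>{1..k}. if z ^ n s = 1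
      then of_int (lam s) * of_nat (N div n s) * z ^ nat (a s mod int (n s)) else 0)"
    using assms by (intro sum.cong refl) (auto simp: sum_arith_progression_powers)
  also have "\<dots> = (\<Sum>s | s \<in> {1..k} \<and> z ^ n s = 1.
      of_int (lam s) * of_nat (N div n s) * z ^ nat (a s mod int (n s)))"
    by (subst sum.inter_filter[symmetric]) auto
  finally show ?thesis .
qed

section \<open>A primitive root of unity and the least prime divisor\<close>

lemma cis_power_eq_1_iff:
  assumes "d > 0"
  shows "cis (2 * pi / real d) ^ j = 1 \<longleftrightarrow> d dvd j"
proof -
  let ?z = "cis (2 * pi / real d)"
  have z: "?z ^ d = 1" using assms by (simp add: Complex.DeMoivre)
  have "?z ^ j = ?z ^ (d * (j div d) + j mod d)" by simp
  also have "\<dots> = ?z ^ (j mod d)"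
    unfolding power_add power_mult z by simp
  also have "\<dots> = cis (2 * pi * real (j mod d) / real d)"
    by (simp add: Complex.DeMoivre mult_ac)
  finally have eq: "?z ^ j = cis (2 * pi * real (j mod d) / real d)" .
  have "inj_on (\<lambda>i. cis (2 * pi * real i / real d)) {..<d}"
    using bij_betw_roots_unity[OF assms] by (simp add: bij_betw_def)
  from inj_on_eq_iff[OF this, of "j mod d" 0] show ?thesis
    using assms by (simp add: eq dvd_eq_mod_eq_0)
qed

lemma least_prime_divisor_le:
  assumes "e dvd d" "e > 1"
  shows "least_prime_divisor d \<le> e"
proof -
  obtain p where p: "prime p" "p dvd e"
    using prime_factor_nat[of e] assms(2) by auto
  then have "least_prime_divisor d \<le> p"
    unfolding least_prime_divisor_def using assms(1) by (intro Least_le) auto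
  also have "p \<le> e" using p assms(2) by (intro dvd_imp_le) auto
  finally show ?thesis .
qed

section \<open>Counting residues modulo d\<close>

theorem theorem1p3:
  fixes k d :: nat and a lam :: "nat \<Rightarrow> int" and n :: "nat \<Rightarrow> nat" and m :: int
  assumes "k > 1"
    and "\<And>s. s \<in> {1..k} \<Longrightarrow> n s > 0"
    and "smallest_period_mod (weight_fun k a n lam) m (n 0)"
    and "d > 0"
    and "\<not> d dvd n 0"
    and "index_set k n d \<noteq> {}"
  shows "int_dvd_rat m
           (of_nat (Lcm (n ` {1..k})) * (\<Sum>s\<in>index_set k n d. of_int (lam s) / of_nat (n s)))
       \<or> (card (index_set k n d) \<ge> card ((\<lambda>s. a s mod int d) ` index_set k n d)
        \<and> card ((\<lambda>s. a s mod int d) ` index_set k n d)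
            \<ge> Min ((\<lambda>s. d div gcd d (n s)) ` ({0..k} - index_set k n d))
        \<and> Min ((\<lambda>s. d div gcd d (n s)) ` ({0..k} - index_set k n d))
            \<ge> least_prime_divisor d)"
proof -
  define I where "I = index_set k n d"
  define J where "J = {0..k} - I"
  define N where "N = Lcm (n ` {1..k})"
  define M where "M = Min ((\<lambda>s. d div gcd d (n s)) ` J)"
  \<comment> \<open>Residues as natural numbers, to serve as exponents; \<open>card_b\<close> shows
    that their number is unchanged.\<close>
  define b where "b = (\<lambda>s. nat (a s mod int d))"
  define w where "w = weight_fun k a n lam"
  have I: "finite I" "I \<subseteq> {1..k}" "\<And>s. s \<in> I \<Longrightarrow> d dvd n s"
    by (auto simp: I_def index_set_def)
  have J: "finite J" "0 \<in> J" by (auto simp: J_def I_def index_set_def)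
  have J_not_dvd: "\<not> d dvd n s" if "s \<in> J" for s
    using that assms(5) by (cases "s = 0") (auto simp: J_def I_def index_set_def)
  have nN: "n s dvd N" if "s \<in> {1..k}" for s
    using that by (auto simp: N_def)
  have "0 \<notin> n ` {1..k}" using assms(2) by fastforce
  then have N: "N > 0" by (auto simp: N_def Lcm_0_iff intro!: Nat.gr0I)
  have dN: "d dvd N" using assms(6) I nN by (metis I_def dvd_trans ex_in_conv subsetD)
  have "n 0 dvd N"
    using smallest_period_mod_dvd[OF assms(3) period_mod_weight_fun] N nN by blast
  have "period_mod w m (n 0)"
    using assms(3) by (simp add: smallest_period_mod_def w_def)

  \<comment> \<open>Because the minimum is attained, \<open>M\<close> is itself a divisor of
    \<open>d\<close>. It is not 1, as \<open>d\<close> does not divide \<open>n s0\<close>.\<close>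
  have "M \<in> (\<lambda>s. d div gcd d (n s)) ` J"
    unfolding M_def using J by (intro Min_in) auto
  then obtain s0 where s0: "s0 \<in> J" "M = d div gcd d (n s0)" by auto
  have "M \<noteq> 0" using assms(4) s0(2) by (simp add: dvd_div_eq_0_iff)
  moreover have "M \<noteq> 1"
    using J_not_dvd[OF s0(1)] s0(2) by (metis dvd_div_mult_self gcd_dvd1 gcd_dvd2 mult_1)
  moreover have "M dvd d" unfolding s0(2) by (simp add: div_dvd_iff_mult assms(4))
  ultimately have prime_le: "least_prime_divisor d \<le> M"
    by (intro least_prime_divisor_le) auto

  have card_b: "card (b ` I) = card ((\<lambda>s. a s mod int d) ` I)"
  proof -
    have "b ` I = nat ` (\<lambda>s. a s mod int d) ` I" by (auto simp: b_def)
    moreover have "inj_on nat ((\<lambda>s. a s mod int d) ` I)"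
      using assms(4) by (intro inj_onI) (auto simp: eq_nat_nat_iff)
    ultimately show ?thesis by (simp add: card_image)
  qed

  define C where "C = (\<lambda>s. lam s * int (N div n s))"
  have dvd: "m dvd sum C I" if less: "card (b ` I) < M"
  proof -
    define zeta where "zeta = cis (2 * pi / real d)"
    note zeta_eq_1 = cis_power_eq_1_iff[OF assms(4), folded zeta_def]
    \<comment> \<open>Grouping by residue makes the number of nodes the number of distinct residues
      rather than the size of \<open>I\<close>.\<close>
    define c where "c = (\<lambda>r. complex_of_int (\<Sum>s | s \<in> I \<and> b s = r. C s))"
    have "(\<Sum>r\<in>b ` I. c r * (zeta ^ j) ^ r) \<in> int_adjoin_multiple m zeta"
      if j: "j \<in> {1..card (b ` I)}" for j
    proof -
      define z where "z = zeta ^ j"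
      have z_eq_1: "z ^ i = 1 \<longleftrightarrow> d dvd j * i" for i
        by (simp add: z_def zeta_eq_1 flip: power_mult)
      \<comment> \<open>From \<open>d dvd j * n s\<close> follows that
        \<open>d div gcd d (n s)\<close> divides the positive number \<open>j\<close>, although
        \<open>j\<close> is below \<open>M\<close> and hence below that quotient.\<close>
      have zJ: "z ^ n s \<noteq> 1" if "s \<in> J" for s
      proof
        assume "z ^ n s = 1"
        then have "d dvd gcd (j * d) (j * n s)" by (simp add: z_eq_1)
        then have "d dvd j * gcd d (n s)" by (simp only: gcd_mult_distrib_nat)
        then have "d div gcd d (n s) dvd j"
          using assms(4) by (subst div_dvd_iff_mult) auto
        then have "d div gcd d (n s) \<le> j" using j by (intro dvd_imp_le) auto
        moreover have "M \<le> d div gcd d (n s)"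
          unfolding M_def using J that by (intro Min_le) auto
        ultimately show False using j less by simp
      qed
      have zN: "z ^ N = 1" using dN by (simp add: z_eq_1)
      have zI: "{s. s \<in> {1..k} \<and> z ^ n s = 1} = I"
        using zJ I by (force simp: J_def z_eq_1)
      \<comment> \<open>Reduction modulo \<open>n s\<close> may be replaced by reduction modulo
        \<open>d\<close>, since \<open>d dvd n s\<close> and \<open>z ^ d = 1\<close>.\<close>
      have zb: "z ^ nat (a s mod int (n s)) = z ^ b s" if "s \<in> I" for s
      proof -
        have "n s > 0" using that I(2) assms(2) by blast
        define r where "r = nat (a s mod int (n s))"
        have "int (r mod d) = a s mod int (n s) mod int d"
          using \<open>n s > 0\<close> by (simp add: r_def of_nat_mod)
        also have "\<dots> = a s mod int d"
          using I(3)[OF that] by (simp add: mod_mod_cancel)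
        finally have "r mod d = b s" by (simp add: b_def flip: nat_int)
        moreover have "z ^ r = z ^ (d * (r div d) + r mod d)" by simp
        moreover have "z ^ d = 1" by (simp add: z_eq_1)
        ultimately show ?thesis by (simp only: power_add power_mult r_def) simp
      qed
      have fourier: "(\<Sum>x<N. of_int (w (int x)) * z ^ x) = (\<Sum>s\<in>I. of_int (C s) * z ^ b s)"
      proof -
        have "(\<Sum>x<N. of_int (w (int x)) * z ^ x)
            = (\<Sum>s | s \<in> {1..k} \<and> z ^ n s = 1.
                of_int (lam s) * of_nat (N div n s) * z ^ nat (a s mod int (n s)))"
          unfolding w_def
          by (rule fourier_coefficient_weight_fun[OF _ zN]) (simp add: nN assms(2))
        also have "\<dots> = (\<Sum>s\<in>I. of_int (C s) * z ^ b s)"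
          by (rule sum.cong[OF zI]) (simp add: zb C_def)
        finally show ?thesis .
      qed
      have "(\<Sum>r\<in>b ` I. c r * z ^ r) = (\<Sum>r\<in>b ` I. \<Sum>s | s \<in> I \<and> b s = r. of_int (C s) * z ^ b s)"
        unfolding c_def of_int_sum sum_distrib_right by (intro sum.cong) auto
      also have "\<dots> = (\<Sum>s\<in>I. of_int (C s) * z ^ b s)"
        using I(1) by (rule sum.image_gen[symmetric])
      also have "\<dots> = (\<Sum>x<N. of_int (w (int x)) * z ^ x)"
        by (rule fourier[symmetric])
      \<comment> \<open>Here \<open>zJ\<close> is used at index 0: it gives \<open>z ^ n 0\<close>
        different from 1.\<close>
      also have "\<dots> \<in> int_adjoin_multiple m z"
        by (rule fourier_coefficient_multiple) (use zN zJ J \<open>n 0 dvd N\<close> \<open>period_mod w m (n 0)\<close> in auto)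
      finally show ?thesis
        unfolding z_def by (rule int_adjoin_multiple_of_power)
    qed
    then have "sum c (b ` I) \<in> int_adjoin_multiple m zeta"
      using exponential_sum_multiple[of "b ` I" zeta d c m] I(1) assms(4) by (simp add: zeta_eq_1)
    moreover have "sum c (b ` I) = of_int (sum C I)"
      unfolding c_def of_int_sum[symmetric] using I(1) by (simp flip: sum.image_gen)
    ultimately show ?thesis
      using assms(4) by (intro int_adjoin_multiple_dvd[of _ m zeta d]) (auto simp: zeta_eq_1)
  qed

  \<comment> \<open>The integer division in \<open>C\<close> is exact because \<open>n s\<close>
    divides \<open>N\<close>, so it agrees with division in the rationals.\<close>
  have "of_int (sum C I) = (of_nat N * (\<Sum>s\<in>I. of_int (lam s) / of_nat (n s)) :: rat)"
  proof -
    have "(of_int (C s) :: rat) = of_nat N * (of_int (lam s) / of_nat (n s))" if "s \<in> I" for s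
    proof -
      have "s \<in> {1..k}" using that I by auto
      then obtain q where "N = n s * q" "n s > 0"
        using nN assms(2) by (metis dvdE)
      then show ?thesis by (simp add: C_def)
    qed
    then show ?thesis by (simp add: sum_distrib_left)
  qed
  then have "int_dvd_rat m (of_nat N * (\<Sum>s\<in>I. of_int (lam s) / of_nat (n s)))"
    if "card (b ` I) < M"
    using dvd[OF that] unfolding int_dvd_rat_def by metis
  moreover have "card ((\<lambda>s. a s mod int d) ` I) \<le> card I"
    using I(1) by (rule card_image_le)
  ultimately show ?thesis
    using prime_le card_b unfolding I_def[symmetric] M_def[symmetric] J_def[symmetric] N_def[symmetric]
    by (metis linorder_not_less)
qed

end
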